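(* Let $G$ be a $3$-tree. Then $\tau(G)\leq \frac{9}{5}\,\nu(G)+\frac{1}{5}$.
   Context: A $3$-tree is a graph obtained from $K_3$ by successively choosing a triangle in the current graph and adding a new vertex adjacent to its three vertices (any finite number of times, possibly zero). $\tau(G)$ is the minimum size of a set of edges of $G$ whose removal leaves a triangle-free graph, and $\nu(G)$ is the maximum number of pairwise edge-disjoint triangles in $G$. *)

theory Defs
  imports Complex_Main
begin

text \<open>Simple graphs are given by a vertex set V and an edge set E of 2-element
vertex sets.\<close>

definition tri_edges :: "'a \<Rightarrow> 'a \<Rightarrow> 'a \<Rightarrow> 'a set set" where
  "tri_edges a b c = {{a,b},{b,c},{a,c}}"

definition triangles :: "'a set set \<Rightarrow> 'a set set" where
  "triangles E = {{a,b,c} | a b c. a \<noteq> b \<and> b \<noteq> c \<and> a \<noteq> c \<and> tri_edges a b c \<subseteq> E}"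

definition triangle_free :: "'a set set \<Rightarrow> bool" where
  "triangle_free E \<longleftrightarrow> triangles E = {}"

inductive three_tree :: "'a set \<Rightarrow> 'a set set \<Rightarrow> bool" where
  base: "\<lbrakk>a \<noteq> b; b \<noteq> c; a \<noteq> c\<rbrakk> \<Longrightarrow> three_tree {a,b,c} (tri_edges a b c)"
| step: "\<lbrakk>three_tree V E; {a,b,c} \<in> triangles E; v \<notin> V\<rbrakk>
          \<Longrightarrow> three_tree (insert v V) (E \<union> {{v,a},{v,b},{v,c}})"

definition tau :: "'a set set \<Rightarrow> nat" where
  "tau E = (LEAST k. \<exists>F. F \<subseteq> E \<and> card F = k \<and> triangle_free (E - F))"

definition edges_of :: "'a set \<Rightarrow> 'a set set" where
  "edges_of T = {e. e \<subseteq> T \<and> card e = 2}"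

definition nu :: "'a set set \<Rightarrow> nat" where
  "nu E = (GREATEST k. \<exists>P. P \<subseteq> triangles E \<and> finite P \<and> card P = k \<and>
      (\<forall>S\<in>P. \<forall>T\<in>P. S \<noteq> T \<longrightarrow> edges_of S \<inter> edges_of T = {}))"

end

theory Submission
  imports Defs
begin

text \<open>
Regard a triangle as the set of its three edges, so that \<open>\<nu>\<close> and \<open>\<tau>\<close> become the packing and
covering numbers of a set system. Everything that the construction hangs below a triangle \<open>T\<close> meets
the rest of the graph only in the three edges of \<open>T\<close>, so it matters only through its packing and
covering numbers for each set \<open>S\<close> of edges of \<open>T\<close> that the packing may use, or that the cover gets
for free. Up to adding \<open>k\<close> to the packing and \<open>l\<close> to the covering numbers with \<open>5 l \<le> 9 k\<close>, nine such
pairs of functions (five up to symmetry) are as bad as any other. Undoing the construction vertex by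
vertex, the parts below the three triangles at the last vertex are merged into the part below the
triangle to which it was attached; the nine pairs are closed under this operation, and for a single
triangle they give \<open>5 \<tau> \<le> 9 \<nu> + 1\<close>.
\<close>

section \<open>Packings and covers of set systems\<close>

text \<open>Only a lower bound is recorded, and as an integer, so that it can be shifted by
  arbitrary offsets. Excluding the empty set keeps packings inside disjoint ground sets from sharing
  a member.\<close>

definition packs :: "'e set \<Rightarrow> 'e set set \<Rightarrow> int \<Rightarrow> bool" where
  "packs A H n \<longleftrightarrow> (\<exists>M\<subseteq>H. finite M \<and> {} \<notin> M \<and> pairwise disjnt M \<and> \<Union>M \<subseteq> A \<and> n \<le> int (card M))"

text \<open>\<open>S\<close> is the part of the cover that comes for free; only \<open>F\<close> is
  charged.\<close>

definition covers :: "'e set \<Rightarrow> 'e set set \<Rightarrow> int \<Rightarrow> bool" where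
  "covers S H n \<longleftrightarrow> (\<exists>F. finite F \<and> (\<forall>t\<in>H. t \<inter> (S \<union> F) \<noteq> {}) \<and> int (card F) \<le> n)"

lemma packsI:
  "\<lbrakk>M \<subseteq> H; finite M; {} \<notin> M; pairwise disjnt M; \<Union>M \<subseteq> A; n \<le> int (card M)\<rbrakk> \<Longrightarrow> packs A H n"
  unfolding packs_def by blast

lemma packsE:
  assumes "packs A H n"
  obtains M where "M \<subseteq> H" "finite M" "{} \<notin> M" "pairwise disjnt M" "\<Union>M \<subseteq> A" "n \<le> int (card M)"
  using assms unfolding packs_def by blast

lemma coversI:
  "\<lbrakk>finite F; \<And>t. t \<in> H \<Longrightarrow> t \<inter> (S \<union> F) \<noteq> {}; int (card F) \<le> n\<rbrakk> \<Longrightarrow> covers S H n"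
  unfolding covers_def by blast

lemma coversE:
  assumes "covers S H n"
  obtains F where "finite F" "\<forall>t\<in>H. t \<inter> (S \<union> F) \<noteq> {}" "int (card F) \<le> n"
  using assms unfolding covers_def by blast

lemma packs_mono:
  assumes "packs A H m" "A \<subseteq> B" "n \<le> m"
  shows "packs B H n"
  using assms(1)
proof (rule packsE)
  fix M assume "M \<subseteq> H" "finite M" "{} \<notin> M" "pairwise disjnt M" "\<Union>M \<subseteq> A" "m \<le> int (card M)"
  with assms(2,3) show ?thesis by (intro packsI[of M]) auto
qed

lemma covers_mono:
  assumes "covers S H m" "S \<subseteq> T" "m \<le> n"
  shows "covers T H n"
  using assms(1)
proof (rule coversE)
  fix F assume F: "finite F" "\<forall>t\<in>H. t \<inter> (S \<union> F) \<noteq> {}" "int (card F) \<le> m"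
  have "t \<inter> (T \<union> F) \<noteq> {}" if "t \<in> H" for t using F(2)[rule_format, OF that] assms(2) by blast
  with F assms(3) show ?thesis by (intro coversI[of F]) auto
qed

lemma packs_Un:
  assumes "packs A H m" "packs B K n" "A \<inter> B = {}"
  shows "packs (A \<union> B) (H \<union> K) (m + n)"
proof -
  obtain M where M: "M \<subseteq> H" "finite M" "{} \<notin> M" "pairwise disjnt M" "\<Union>M \<subseteq> A" "m \<le> int (card M)"
    using assms(1) by (rule packsE)
  obtain N where N: "N \<subseteq> K" "finite N" "{} \<notin> N" "pairwise disjnt N" "\<Union>N \<subseteq> B" "n \<le> int (card N)"
    using assms(2) by (rule packsE)
  have disj: "disjnt s t" if "s \<in> M" "t \<in> N" for s t
    using that M(5) N(5) assms(3) unfolding disjnt_def by blast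
  \<comment> \<open>A common member would be disjoint from itself, hence empty.\<close>
  have "M \<inter> N = {}"
  proof (rule ccontr)
    assume "M \<inter> N \<noteq> {}"
    then obtain t where "t \<in> M" "t \<in> N" by blast
    with disj[of t t] M(3) show False by (simp add: disjnt_def)
  qed
  then have "card (M \<union> N) = card M + card N" using M N by (simp add: card_Un_disjoint)
  moreover have "pairwise disjnt (M \<union> N)"
    using M(4) N(4) disj unfolding pairwise_def by (metis Un_iff disjnt_sym)
  ultimately show ?thesis using M N by (intro packsI[of "M \<union> N"]) auto
qed

lemma covers_Un:
  assumes "covers S H m" "covers T K n"
  shows "covers (S \<union> T) (H \<union> K) (m + n)"
proof -
  obtain F where F: "finite F" "\<forall>t\<in>H. t \<inter> (S \<union> F) \<noteq> {}" "int (card F) \<le> m"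
    using assms(1) by (rule coversE)
  obtain G where G: "finite G" "\<forall>t\<in>K. t \<inter> (T \<union> G) \<noteq> {}" "int (card G) \<le> n"
    using assms(2) by (rule coversE)
  have "int (card (F \<union> G)) \<le> m + n" using F(3) G(3) card_Un_le[of F G] by linarith
  moreover have "t \<inter> (S \<union> T \<union> (F \<union> G)) \<noteq> {}" if "t \<in> H \<union> K" for t
    using that F(2) G(2) by blast
  ultimately show ?thesis using F(1) G(1) by (intro coversI[of "F \<union> G"]) auto
qed

text \<open>The elements of \<open>T\<close> stop being free and are bought, at a price of at most
  \<open>m\<close>.\<close>

lemma covers_pay:
  assumes "covers (S \<union> T) H n" "finite T" "int (card T) \<le> m"
  shows "covers S H (n + m)"
proof -
  obtain F where F: "finite F" "\<forall>t\<in>H. t \<inter> (S \<union> T \<union> F) \<noteq> {}" "int (card F) \<le> n"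
    using assms(1) by (rule coversE)
  have "int (card (T \<union> F)) \<le> n + m" using F(3) assms(3) card_Un_le[of T F] by linarith
  moreover have "t \<inter> (S \<union> (T \<union> F)) \<noteq> {}" if "t \<in> H" for t
    using F(2)[rule_format, OF that] by (simp add: Un_assoc)
  ultimately show ?thesis using F(1) assms(2) by (intro coversI[of "T \<union> F"]) auto
qed

section \<open>Gadgets on a root triangle\<close>

definition sel :: "'e \<Rightarrow> 'e \<Rightarrow> 'e \<Rightarrow> bool \<Rightarrow> bool \<Rightarrow> bool \<Rightarrow> 'e set" where
  "sel x y z i j m = {e. e = x \<and> i \<or> e = y \<and> j \<or> e = z \<and> m}"

section \<open>Tables indexed by the subsets of the three root edges\<close>

datatype vec = Vec int int int int int int int int

fun val :: "vec \<Rightarrow> bool \<Rightarrow> bool \<Rightarrow> bool \<Rightarrow> int" where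
  "val (Vec a b c d e f g h) False False False = a"
| "val (Vec a b c d e f g h) True False False = b"
| "val (Vec a b c d e f g h) False True False = c"
| "val (Vec a b c d e f g h) False False True = d"
| "val (Vec a b c d e f g h) True True False = e"
| "val (Vec a b c d e f g h) True False True = f"
| "val (Vec a b c d e f g h) False True True = g"
| "val (Vec a b c d e f g h) True True True = h"

text \<open>Tabulation turns optimising over three bits into \<open>vmax\<close> and
  \<open>vmin\<close>, so that the closure checks below become evaluation on explicit
  tables.\<close>

definition tab :: "(bool \<Rightarrow> bool \<Rightarrow> bool \<Rightarrow> int) \<Rightarrow> vec" where
  "tab f = Vec (f False False False) (f True False False) (f False True False) (f False False True)
     (f True True False) (f True False True) (f False True True) (f True True True)"

fun vmax :: "vec \<Rightarrow> int" where
  "vmax (Vec a b c d e f g h) = max (max (max a b) (max c d)) (max (max e f) (max g h))"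

fun vmin :: "vec \<Rightarrow> int" where
  "vmin (Vec a b c d e f g h) = min (min (min a b) (min c d)) (min (min e f) (min g h))"

fun vsub :: "vec \<Rightarrow> vec \<Rightarrow> vec" where
  "vsub (Vec a b c d e f g h) (Vec a' b' c' d' e' f' g' h') =
     Vec (a - a') (b - b') (c - c') (d - d') (e - e') (f - f') (g - g') (h - h')"

abbreviation size3 :: vec where
  "size3 \<equiv> Vec 0 1 1 1 2 2 2 3"

lemma val_tab [simp]: "val (tab f) i j m = f i j m"
  by (cases i; cases j; cases m) (simp_all add: tab_def)

lemma val_le_vmax: "val P i j m \<le> vmax P"
  by (cases P; cases i; cases j; cases m) auto

lemma vmin_le_val: "vmin P \<le> val P i j m"
  by (cases P; cases i; cases j; cases m) auto

lemma val_vsub: "val (vsub P Q) i j m = val P i j m - val Q i j m"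
  by (cases P; cases Q; cases i; cases j; cases m) auto

lemma vmax_attained: "\<exists>i j m. vmax P = val P i j m"
proof (cases P)
  case (Vec a b c d e f g h)
  have max_in: "max p q \<in> A" if "p \<in> A" "q \<in> A" for p q :: int and A
    using that by (simp add: max_def)
  have "vmax P \<in> {a, b, c, d, e, f, g, h}"
    unfolding Vec vmax.simps by (intro max_in) simp_all
  then show ?thesis unfolding Vec by (simp only: insert_iff empty_iff) (metis val.simps)
qed

lemma vmin_attained: "\<exists>i j m. vmin P = val P i j m"
proof (cases P)
  case (Vec a b c d e f g h)
  have min_in: "min p q \<in> A" if "p \<in> A" "q \<in> A" for p q :: int and A
    using that by (simp add: min_def)
  have "vmin P \<in> {a, b, c, d, e, f, g, h}"
    unfolding Vec vmin.simps by (intro min_in) simp_all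
  then show ?thesis unfolding Vec by (simp only: insert_iff empty_iff) (metis val.simps)
qed

lemma finite_sel [simp]: "finite (sel x y z i j m)"
  by (rule finite_subset[of _ "{x, y, z}"]) (auto simp: sel_def)

lemma card_sel_le: "int (card (sel x y z i j m)) \<le> val size3 i j m"
proof -
  \<comment> \<open>Repeated edges only lower the cardinality, so the length of this list bounds it
    from above.\<close>
  let ?xs = "(if i then [x] else []) @ (if j then [y] else []) @ (if m then [z] else [])"
  have "sel x y z i j m = set ?xs"
    by (cases i; cases j; cases m) (auto simp: sel_def)
  then have "card (sel x y z i j m) \<le> length ?xs"
    using card_length by metis
  then show ?thesis by (cases i; cases j; cases m) auto
qed

text \<open>\<open>D\<close> holds the edges private to the part hanging below the root: a packing
  may use all of them besides the selected root edges. \<open>P\<close> and \<open>Q\<close> give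
  the shape, \<open>k\<close> and \<open>l\<close> the offsets; each bounds its number from one side
  only.\<close>

definition realizes :: "'e \<Rightarrow> 'e \<Rightarrow> 'e \<Rightarrow> 'e set \<Rightarrow> 'e set set \<Rightarrow> vec \<Rightarrow> vec \<Rightarrow> int \<Rightarrow> int \<Rightarrow> bool" where
  "realizes x y z D H P Q k l \<longleftrightarrow> (\<forall>i j m.
     packs (D \<union> sel x y z i j m) H (val P i j m + k) \<and> covers (sel x y z i j m) H (val Q i j m + l))"

text \<open>
The worst cases, found by computer search. Entries are indexed by the subsets of the root edges in
the order of the equations of \<^const>\<open>val\<close>; the number \<open>d\<close> in \<open>(P, Q, d)\<close> is the surplus \<open>9 k - 5 l\<close>
that comes with the shape. The first entry is a bare triangle, the second one \<open>K\<^sub>4\<close>, and the third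
two copies of \<open>K\<^sub>4\<close> glued along the root.
\<close>

definition gadgets :: "(vec \<times> vec \<times> int) list" where
  "gadgets =
    [(Vec 0 0 0 0 0 0 0 1, Vec 1 0 0 0 0 0 0 0, 0),
     (Vec 0 1 1 1 1 1 1 1, Vec 2 1 1 1 1 1 1 0, 0),
     (Vec 0 1 1 1 2 2 2 2, Vec 3 2 2 2 1 1 1 0, 0),
     (Vec 0 0 1 1 1 1 1 1, Vec 2 1 1 1 1 1 1 0, 4),
     (Vec 0 1 0 1 1 1 1 1, Vec 2 1 1 1 1 1 1 0, 4),
     (Vec 0 1 1 0 1 1 1 1, Vec 2 1 1 1 1 1 1 0, 4),
     (Vec 0 0 1 1 1 1 2 2, Vec 3 2 2 2 1 1 1 0, 8),
     (Vec 0 1 0 1 1 2 1 2, Vec 3 2 2 2 1 1 1 0, 8),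
     (Vec 0 1 1 0 2 1 1 2, Vec 3 2 2 2 1 1 1 0, 8)]"

definition good :: "'e \<Rightarrow> 'e \<Rightarrow> 'e \<Rightarrow> 'e set \<Rightarrow> 'e set set \<Rightarrow> bool" where
  "good x y z D H \<longleftrightarrow>
     (\<exists>(P, Q, d)\<in>set gadgets. \<exists>k l. 5 * l + d \<le> 9 * k \<and> realizes x y z D H P Q k l)"

lemma goodI:
  "\<lbrakk>(P, Q, d) \<in> set gadgets; 5 * l + d \<le> 9 * k; realizes x y z D H P Q k l\<rbrakk> \<Longrightarrow> good x y z D H"
  unfolding good_def by (rule bexI[of _ "(P, Q, d)"]) auto

lemma goodE:
  assumes "good x y z D H"
  obtains P Q d k l where "(P, Q, d) \<in> set gadgets" "5 * l + d \<le> 9 * k" "realizes x y z D H P Q k l"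
  using assms unfolding good_def by (elim bexE) auto

text \<open>\<open>vmin\<close> gives the largest shift that keeps \<open>P'\<close> below
  \<open>P\<close>, and \<open>vmax\<close> the smallest shift that lifts \<open>Q'\<close> above
  \<open>Q\<close>. The test asks whether the surplus left after these shifts is still at least
  \<open>d'\<close>. The conditional lets evaluation stop at the first hit.\<close>

fun dominated :: "vec \<Rightarrow> vec \<Rightarrow> int \<Rightarrow> (vec \<times> vec \<times> int) list \<Rightarrow> bool" where
  "dominated P Q d [] = False"
| "dominated P Q d ((P', Q', d') # gs) =
     (if 5 * vmax (vsub Q Q') + d' \<le> 9 * vmin (vsub P P') + d then True else dominated P Q d gs)"

lemma dominatedD:
  "dominated P Q d gs \<Longrightarrow>
     \<exists>(P', Q', d')\<in>set gs. 5 * vmax (vsub Q Q') + d' \<le> 9 * vmin (vsub P P') + d"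
  by (induction gs) (auto split: if_splits)

lemma good_if_dominated:
  assumes "realizes x y z D H P Q k l" "5 * l + d \<le> 9 * k" "dominated P Q d gadgets"
  shows "good x y z D H"
proof -
  obtain P' Q' d' where g: "(P', Q', d') \<in> set gadgets"
    and le: "5 * vmax (vsub Q Q') + d' \<le> 9 * vmin (vsub P P') + d"
    using dominatedD[OF assms(3)] by blast
  have P: "val P' i j m + (k + vmin (vsub P P')) \<le> val P i j m + k"
    and Q: "val Q i j m + l \<le> val Q' i j m + (l + vmax (vsub Q Q'))" for i j m
    using vmin_le_val[of "vsub P P'" i j m] val_le_vmax[of "vsub Q Q'" i j m]
    by (simp_all add: val_vsub)
  have "realizes x y z D H P' Q' (k + vmin (vsub P P')) (l + vmax (vsub Q Q'))"
    unfolding realizes_def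
  proof (intro allI conjI)
    fix i j m
    have *: "packs (D \<union> sel x y z i j m) H (val P i j m + k)" "covers (sel x y z i j m) H (val Q i j m + l)"
      using assms(1) unfolding realizes_def by simp_all
    show "packs (D \<union> sel x y z i j m) H (val P' i j m + (k + vmin (vsub P P')))"
      using *(1) order_refl P by (rule packs_mono)
    show "covers (sel x y z i j m) H (val Q' i j m + (l + vmax (vsub Q Q')))"
      using *(2) order_refl Q by (rule covers_mono)
  qed
  moreover have "5 * (l + vmax (vsub Q Q')) + d' \<le> 9 * (k + vmin (vsub P P'))"
    using le assms(2) by (simp add: algebra_simps)
  ultimately show ?thesis by (intro goodI[OF g])
qed

lemma good_triangle: "good x y z {} {{x, y, z}}"
proof -
  have "packs ({} \<union> sel x y z i j m) {{x, y, z}} (val (Vec 0 0 0 0 0 0 0 1) i j m + 0)" for i j m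
  proof (cases "i \<and> j \<and> m")
    case True
    then show ?thesis by (intro packsI[of "{{x, y, z}}"]) (auto simp: sel_def)
  next
    case False
    then show ?thesis by (intro packsI[of "{}"]) (cases i; cases j; cases m; auto)+
  qed
  moreover have "covers (sel x y z i j m) {{x, y, z}} (val (Vec 1 0 0 0 0 0 0 0) i j m + 0)" for i j m
  proof (cases "i \<or> j \<or> m")
    case True
    then show ?thesis by (intro coversI[of "{}"]) (cases i; cases j; cases m; auto simp: sel_def)+
  next
    case False
    then show ?thesis by (intro coversI[of "{x}"]) auto
  qed
  ultimately have "realizes x y z {} {{x, y, z}} (Vec 0 0 0 0 0 0 0 1) (Vec 1 0 0 0 0 0 0 0) 0 0"
    unfolding realizes_def by simp
  then show ?thesis by (rule goodI[where d = 0, rotated 2]) (simp_all add: gadgets_def)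
qed

subsection \<open>Two gadgets on the same triangle\<close>

text \<open>The bits share out the available root edges: a true bit reserves the edge for
  \<open>A\<close>, a false one for \<open>B\<close>.\<close>

definition glueP :: "vec \<Rightarrow> vec \<Rightarrow> bool \<Rightarrow> bool \<Rightarrow> bool \<Rightarrow> int" where
  "glueP A B i j m = vmax (tab (\<lambda>u v w.
     val A (i \<and> u) (j \<and> v) (m \<and> w) + val B (i \<and> \<not> u) (j \<and> \<not> v) (m \<and> \<not> w)))"

text \<open>The bits mark root edges bought by the cover at the price \<open>size3\<close>; a bought
  edge then serves both gadgets.\<close>

definition glueQ :: "vec \<Rightarrow> vec \<Rightarrow> bool \<Rightarrow> bool \<Rightarrow> bool \<Rightarrow> int" where
  "glueQ A B i j m = vmin (tab (\<lambda>u v w.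
     val A (i \<or> u) (j \<or> v) (m \<or> w) + val B (i \<or> u) (j \<or> v) (m \<or> w) + val size3 u v w))"

text \<open>Since the private edges avoid each other and the root, packings of the two parts compete
  only for root edges. The two covers can share whatever is bought on the root.\<close>

lemma realizes_glue:
  assumes "realizes x y z D1 H1 P1 Q1 k1 l1" "realizes x y z D2 H2 P2 Q2 k2 l2"
    and "distinct [x, y, z]" "D1 \<inter> D2 = {}" "(D1 \<union> D2) \<inter> {x, y, z} = {}"
  shows "realizes x y z (D1 \<union> D2) (H1 \<union> H2) (tab (glueP P1 P2)) (tab (glueQ Q1 Q2)) (k1 + k2) (l1 + l2)"
  unfolding realizes_def val_tab
proof (intro allI conjI)
  fix i j m
  obtain u v w where eq: "glueP P1 P2 i j m
      = val P1 (i \<and> u) (j \<and> v) (m \<and> w) + val P2 (i \<and> \<not> u) (j \<and> \<not> v) (m \<and> \<not> w)"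
    unfolding glueP_def using vmax_attained[of "tab _"] by (metis (no_types, lifting) val_tab)
  let ?A = "D1 \<union> sel x y z (i \<and> u) (j \<and> v) (m \<and> w)"
  let ?B = "D2 \<union> sel x y z (i \<and> \<not> u) (j \<and> \<not> v) (m \<and> \<not> w)"
  have "?A \<inter> ?B = {}" using assms(3-5) by (auto simp: sel_def)
  then have "packs (?A \<union> ?B) (H1 \<union> H2) ((val P1 (i \<and> u) (j \<and> v) (m \<and> w) + k1)
      + (val P2 (i \<and> \<not> u) (j \<and> \<not> v) (m \<and> \<not> w) + k2))"
    using assms(1,2) unfolding realizes_def by (intro packs_Un) blast+
  moreover have "?A \<union> ?B \<subseteq> D1 \<union> D2 \<union> sel x y z i j m" by (auto simp: sel_def)
  ultimately show "packs (D1 \<union> D2 \<union> sel x y z i j m) (H1 \<union> H2) (glueP P1 P2 i j m + (k1 + k2))"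
    unfolding eq by (rule packs_mono) simp
next
  fix i j m
  obtain u v w where eq: "glueQ Q1 Q2 i j m
      = val Q1 (i \<or> u) (j \<or> v) (m \<or> w) + val Q2 (i \<or> u) (j \<or> v) (m \<or> w) + val size3 u v w"
    unfolding glueQ_def using vmin_attained[of "tab _"] by (metis (no_types, lifting) val_tab)
  let ?S = "sel x y z (i \<or> u) (j \<or> v) (m \<or> w)"
  have "covers (?S \<union> ?S) (H1 \<union> H2) ((val Q1 (i \<or> u) (j \<or> v) (m \<or> w) + l1)
      + (val Q2 (i \<or> u) (j \<or> v) (m \<or> w) + l2))"
    using assms(1,2) unfolding realizes_def by (intro covers_Un) blast+
  \<comment> \<open>The set used as free splits into what is really given and what is bought;
    \<open>covers_pay\<close> charges for the latter.\<close>
  moreover have "?S \<union> ?S = sel x y z i j m \<union> sel x y z u v w" by (auto simp: sel_def)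
  ultimately have "covers (sel x y z i j m) (H1 \<union> H2) ((val Q1 (i \<or> u) (j \<or> v) (m \<or> w) + l1)
      + (val Q2 (i \<or> u) (j \<or> v) (m \<or> w) + l2) + val size3 u v w)"
    using covers_pay[OF _ finite_sel card_sel_le] by metis
  then show "covers (sel x y z i j m) (H1 \<union> H2) (glueQ Q1 Q2 i j m + (l1 + l2))"
    unfolding eq by (rule covers_mono) simp_all
qed

text \<open>Closure of the worst cases under gluing, by evaluating all 81 ordered pairs; surpluses
  add up.\<close>

lemma glue_check:
  "list_all (\<lambda>(A, A', a). list_all (\<lambda>(B, B', b).
     dominated (tab (glueP A B)) (tab (glueQ A' B')) (a + b) gadgets) gadgets) gadgets"
  by code_simp

lemma good_glue:
  assumes "good x y z D1 H1" "good x y z D2 H2"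
    and "distinct [x, y, z]" "D1 \<inter> D2 = {}" "(D1 \<union> D2) \<inter> {x, y, z} = {}"
  shows "good x y z (D1 \<union> D2) (H1 \<union> H2)"
proof -
  obtain A A' a k1 l1 where 1: "(A, A', a) \<in> set gadgets" "5 * l1 + a \<le> 9 * k1"
      "realizes x y z D1 H1 A A' k1 l1"
    using assms(1) by (rule goodE)
  obtain B B' b k2 l2 where 2: "(B, B', b) \<in> set gadgets" "5 * l2 + b \<le> 9 * k2"
      "realizes x y z D2 H2 B B' k2 l2"
    using assms(2) by (rule goodE)
  have "5 * (l1 + l2) + (a + b) \<le> 9 * (k1 + k2)" using 1(2) 2(2) by simp
  moreover have "dominated (tab (glueP A B)) (tab (glueQ A' B')) (a + b) gadgets"
    using glue_check 1(1) 2(1) unfolding list_all_iff by fast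
  ultimately show ?thesis
    by (rule good_if_dominated[OF realizes_glue[OF 1(3) 2(3) assms(3-5)]])
qed

subsection \<open>Three gadgets on the new triangles of a vertex\<close>

text \<open>The bits \<open>u\<close>, \<open>v\<close>, \<open>w\<close> belong to the edges at the
  new vertex. Each such edge lies in two of the three new triangles, and its bit decides which may
  use it: \<open>u\<close> goes to \<open>A\<close> or \<open>C\<close>, \<open>v\<close> to
  \<open>A\<close> or \<open>B\<close>, \<open>w\<close> to \<open>B\<close> or \<open>C\<close>. A
  root edge lies in just one new triangle and is passed on to it.\<close>

definition extP :: "vec \<Rightarrow> vec \<Rightarrow> vec \<Rightarrow> bool \<Rightarrow> bool \<Rightarrow> bool \<Rightarrow> int" where
  "extP A B C i j m = vmax (tab (\<lambda>u v w. val A i v u + val B j w (\<not> v) + val C m (\<not> u) (\<not> w)))"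

text \<open>Here the bits mark the edges at the new vertex that are bought; each serves both new
  triangles containing it.\<close>

definition extQ :: "vec \<Rightarrow> vec \<Rightarrow> vec \<Rightarrow> bool \<Rightarrow> bool \<Rightarrow> bool \<Rightarrow> int" where
  "extQ A B C i j m =
     vmin (tab (\<lambda>u v w. val A i v u + val B j w v + val C m u w + val size3 u v w))"

text \<open>After the merge the edges \<open>u\<close>, \<open>v\<close>, \<open>w\<close> are
  private. The root triangle itself is not added here; in the application it comes with the gadget
  that the root already carries.\<close>

lemma realizes_ext:
  assumes "realizes x v u D1 H1 P1 Q1 k1 l1" "realizes y w v D2 H2 P2 Q2 k2 l2"
      "realizes z u w D3 H3 P3 Q3 k3 l3"
    and "distinct [x, y, z, u, v, w]" "D1 \<inter> D2 = {}" "D1 \<inter> D3 = {}" "D2 \<inter> D3 = {}"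
      "(D1 \<union> D2 \<union> D3) \<inter> {x, y, z, u, v, w} = {}"
  shows "realizes x y z (D1 \<union> D2 \<union> D3 \<union> {u, v, w}) (H1 \<union> H2 \<union> H3)
    (tab (extP P1 P2 P3)) (tab (extQ Q1 Q2 Q3)) (k1 + k2 + k3) (l1 + l2 + l3)"
  unfolding realizes_def val_tab
proof (intro allI conjI)
  fix i j m
  obtain a b c where eq: "extP P1 P2 P3 i j m
      = val P1 i b a + val P2 j c (\<not> b) + val P3 m (\<not> a) (\<not> c)"
    unfolding extP_def using vmax_attained[of "tab _"] by (metis (no_types, lifting) val_tab)
  let ?A = "D1 \<union> sel x v u i b a"
  let ?B = "D2 \<union> sel y w v j c (\<not> b)"
  let ?C = "D3 \<union> sel z u w m (\<not> a) (\<not> c)"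
  have "?A \<inter> ?B = {}" "(?A \<union> ?B) \<inter> ?C = {}" using assms(4-8) by (auto simp: sel_def)
  then have "packs (?A \<union> ?B \<union> ?C) (H1 \<union> H2 \<union> H3) ((val P1 i b a + k1)
      + (val P2 j c (\<not> b) + k2) + (val P3 m (\<not> a) (\<not> c) + k3))"
    using assms(1-3) unfolding realizes_def by (intro packs_Un) blast+
  moreover have "?A \<union> ?B \<union> ?C \<subseteq> D1 \<union> D2 \<union> D3 \<union> {u, v, w} \<union> sel x y z i j m"
    by (auto simp: sel_def)
  ultimately show "packs (D1 \<union> D2 \<union> D3 \<union> {u, v, w} \<union> sel x y z i j m) (H1 \<union> H2 \<union> H3)
      (extP P1 P2 P3 i j m + (k1 + k2 + k3))"
    unfolding eq by (rule packs_mono) simp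
next
  fix i j m
  obtain a b c where eq: "extQ Q1 Q2 Q3 i j m
      = val Q1 i b a + val Q2 j c b + val Q3 m a c + val size3 a b c"
    unfolding extQ_def using vmin_attained[of "tab _"] by (metis (no_types, lifting) val_tab)
  have "covers (sel x v u i b a \<union> sel y w v j c b \<union> sel z u w m a c) (H1 \<union> H2 \<union> H3)
      ((val Q1 i b a + l1) + (val Q2 j c b + l2) + (val Q3 m a c + l3))"
    using assms(1-3) unfolding realizes_def by (intro covers_Un) blast+
  moreover have "sel x v u i b a \<union> sel y w v j c b \<union> sel z u w m a c
      = sel x y z i j m \<union> sel u v w a b c" by (auto simp: sel_def)
  ultimately have "covers (sel x y z i j m) (H1 \<union> H2 \<union> H3)
      ((val Q1 i b a + l1) + (val Q2 j c b + l2) + (val Q3 m a c + l3) + val size3 a b c)"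
    using covers_pay[OF _ finite_sel card_sel_le] by metis
  then show "covers (sel x y z i j m) (H1 \<union> H2 \<union> H3) (extQ Q1 Q2 Q3 i j m + (l1 + l2 + l3))"
    unfolding eq by (rule covers_mono) simp_all
qed

text \<open>
The result can be replaced by the bare root triangle. This happens for all but five of the \<open>9\<^sup>3\<close>
triples, and testing five values instead of sixteen keeps the check below feasible.
\<close>

fun reducible :: "(vec \<times> vec \<times> int) \<Rightarrow> (vec \<times> vec \<times> int) \<Rightarrow> (vec \<times> vec \<times> int) \<Rightarrow> bool" where
  "reducible (A, A', a) (B, B', b) (C, C', c) \<longleftrightarrow>
     5 * max (max (extQ A' B' C' True False False) (extQ A' B' C' False True False))
       (extQ A' B' C' False False True)
     \<le> 9 * min (extP A B C False False False) (extP A B C True True True - 1) + (a + b + c)"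

text \<open>By monotonicity, comparison with the bare triangle needs few entries: for the packing
  only the empty and the full set of root edges, for the cover only the single edges, because larger
  sets help and the empty set costs at most one more edge.\<close>

lemma good_if_reducible:
  assumes real: "realizes x y z D H (tab (extP A B C)) (tab (extQ A' B' C')) k l"
    and le: "5 * l + (a + b + c) \<le> 9 * k" and red: "reducible (A, A', a) (B, B', b) (C, C', c)"
  shows "good x y z D H"
proof -
  \<comment> \<open>The bare triangle packs 1 exactly when all root edges are available, hence the
    \<open>- 1\<close> at the full set.\<close>
  let ?m = "min (extP A B C False False False) (extP A B C True True True - 1)"
  let ?M = "max (max (extQ A' B' C' True False False) (extQ A' B' C' False True False))
       (extQ A' B' C' False False True)"
  have pk: "packs (D \<union> sel x y z i j n) H (extP A B C i j n + k)"
    and cv: "covers (sel x y z i j n) H (extQ A' B' C' i j n + l)" for i j n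
    using real unfolding realizes_def val_tab by blast+
  have "packs (D \<union> sel x y z i j n) H (val (Vec 0 0 0 0 0 0 0 1) i j n + (?m + k))" for i j n
  proof (cases "i \<and> j \<and> n")
    case True
    then show ?thesis using packs_mono[OF pk[of True True True]] by auto
  next
    case False
    then have "val (Vec 0 0 0 0 0 0 0 1) i j n = 0" by (cases i; cases j; cases n) auto
    then show ?thesis
      using packs_mono[OF pk[of False False False]] by (auto simp: sel_def)
  qed
  moreover have "covers (sel x y z i j n) H (val (Vec 1 0 0 0 0 0 0 0) i j n + (?M + l))" for i j n
  proof (cases "i \<or> j \<or> n")
    case True
    then have 0: "val (Vec 1 0 0 0 0 0 0 0) i j n = 0" by (cases i; cases j; cases n) auto
    from True consider i | j | n by blast
    then show ?thesis
    proof cases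
      case 1
      then show ?thesis unfolding 0 by (intro covers_mono[OF cv[of True False False]]) (auto simp: sel_def)
    next
      case 2
      then show ?thesis unfolding 0 by (intro covers_mono[OF cv[of False True False]]) (auto simp: sel_def)
    next
      case 3
      then show ?thesis unfolding 0 by (intro covers_mono[OF cv[of False False True]]) (auto simp: sel_def)
    qed
  next
    case False
    \<comment> \<open>With no root edge free, \<open>x\<close> is bought; this matches the entry 1
      of the bare triangle.\<close>
    have "covers ({} \<union> {x}) H (extQ A' B' C' True False False + l)"
      using cv[of True False False] by (simp add: sel_def)
    then have "covers {} H (extQ A' B' C' True False False + l + 1)" by (rule covers_pay) auto
    then show ?thesis using False by (auto elim!: covers_mono)
  qed
  ultimately have "realizes x y z D H (Vec 0 0 0 0 0 0 0 1) (Vec 1 0 0 0 0 0 0 0) (?m + k) (?M + l)"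
    unfolding realizes_def by blast
  moreover have "5 * (?M + l) + 0 \<le> 9 * (?m + k)" using le red by simp
  moreover have "(Vec 0 0 0 0 0 0 0 1, Vec 1 0 0 0 0 0 0 0, 0) \<in> set gadgets" by (simp add: gadgets_def)
  ultimately show ?thesis by (intro goodI)
qed

text \<open>Closure under merging at a vertex, by evaluating all 729 triples; the conditional tries
  the cheap test first.\<close>

lemma ext_check:
  "list_all (\<lambda>(A, A', a). list_all (\<lambda>(B, B', b). list_all (\<lambda>(C, C', c).
     if reducible (A, A', a) (B, B', b) (C, C', c) then True
     else dominated (tab (extP A B C)) (tab (extQ A' B' C')) (a + b + c) gadgets) gadgets) gadgets) gadgets"
  by code_simp

lemma good_ext:
  assumes "good x v u D1 H1" "good y w v D2 H2" "good z u w D3 H3"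
    and "distinct [x, y, z, u, v, w]" "D1 \<inter> D2 = {}" "D1 \<inter> D3 = {}" "D2 \<inter> D3 = {}"
      "(D1 \<union> D2 \<union> D3) \<inter> {x, y, z, u, v, w} = {}"
  shows "good x y z (D1 \<union> D2 \<union> D3 \<union> {u, v, w}) (H1 \<union> H2 \<union> H3)"
proof -
  obtain A A' a k1 l1 where 1: "(A, A', a) \<in> set gadgets" "5 * l1 + a \<le> 9 * k1"
      "realizes x v u D1 H1 A A' k1 l1"
    using assms(1) by (rule goodE)
  obtain B B' b k2 l2 where 2: "(B, B', b) \<in> set gadgets" "5 * l2 + b \<le> 9 * k2"
      "realizes y w v D2 H2 B B' k2 l2"
    using assms(2) by (rule goodE)
  obtain C C' c k3 l3 where 3: "(C, C', c) \<in> set gadgets" "5 * l3 + c \<le> 9 * k3"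
      "realizes z u w D3 H3 C C' k3 l3"
    using assms(3) by (rule goodE)
  note real = realizes_ext[OF 1(3) 2(3) 3(3) assms(4-8)]
  have le: "5 * (l1 + l2 + l3) + (a + b + c) \<le> 9 * (k1 + k2 + k3)" using 1(2) 2(2) 3(2) by simp
  have "reducible (A, A', a) (B, B', b) (C, C', c) \<or>
      dominated (tab (extP A B C)) (tab (extQ A' B' C')) (a + b + c) gadgets"
    using ext_check 1(1) 2(1) 3(1) unfolding list_all_iff by (fastforce split: if_splits)
  then show ?thesis
    by (elim disjE) (fact good_if_reducible[OF real le], fact good_if_dominated[OF real le])
qed

text \<open>At the top level the packing may use all root edges and the cover gets none for free, so
  one entry of each table matters.\<close>

lemma good_bound:
  assumes "good x y z D H"
  obtains k l where "5 * l \<le> 9 * k + 1" "packs UNIV H k" "covers {} H l"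
proof -
  obtain P Q d k l where g: "(P, Q, d) \<in> set gadgets" and le: "5 * l + d \<le> 9 * k"
    and r: "realizes x y z D H P Q k l"
    using assms by (rule goodE)
  \<comment> \<open>Equality holds only for the \<open>K\<^sub>4\<close> entry, as
    \<open>5 * 2 = 9 * 1 + 1\<close>; this is the source of the additive 1/5.\<close>
  have "5 * val Q False False False \<le> 9 * val P True True True + d + 1"
    using g by (auto simp: gadgets_def)
  then have "5 * (val Q False False False + l) \<le> 9 * (val P True True True + k) + 1" using le by simp
  moreover have "packs UNIV H (val P True True True + k)"
    using r unfolding realizes_def by (blast intro: packs_mono)
  moreover have "covers {} H (val Q False False False + l)"
    using r[unfolded realizes_def, rule_format, of False False False] by (simp add: sel_def)
  ultimately show ?thesis using that by blast
qed

section \<open>Triangles of 3-trees\<close>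

lemma edges_of_triple:
  assumes "a \<noteq> b" "b \<noteq> c" "a \<noteq> c"
  shows "edges_of {a, b, c} = tri_edges a b c"
proof
  show "edges_of {a, b, c} \<subseteq> tri_edges a b c"
    unfolding edges_of_def tri_edges_def card_2_iff by (auto simp: doubleton_eq_iff)
  show "tri_edges a b c \<subseteq> edges_of {a, b, c}"
    using assms unfolding edges_of_def tri_edges_def by auto
qed

lemma triangles_iff: "t \<in> triangles E \<longleftrightarrow> card t = 3 \<and> edges_of t \<subseteq> E"
proof
  assume "t \<in> triangles E"
  then show "card t = 3 \<and> edges_of t \<subseteq> E"
    unfolding triangles_def by (auto simp: edges_of_triple)
next
  assume t: "card t = 3 \<and> edges_of t \<subseteq> E"
  then obtain a b c where "t = {a, b, c}" "a \<noteq> b" "b \<noteq> c" "a \<noteq> c"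
    by (auto simp: card_3_iff)
  with t show "t \<in> triangles E"
    unfolding triangles_def by (auto simp: edges_of_triple)
qed

lemma card_3_distinct: "card {a, b, c} = 3 \<Longrightarrow> a \<noteq> b \<and> b \<noteq> c \<and> a \<noteq> c"
  by (auto simp: card_insert_if split: if_splits)

lemma Union_edges_of: "card t = 3 \<Longrightarrow> \<Union>(edges_of t) = t"
  by (auto simp: card_3_iff edges_of_triple tri_edges_def)

text \<open>A triangle is recovered as the union of its edges.\<close>

lemma inj_on_edges_of: "inj_on edges_of (triangles E)"
  by (metis Union_edges_of inj_onI triangles_iff)

lemma triangles_single:
  assumes "card t = 3"
  shows "triangles (edges_of t) = {t}"
proof -
  have "s = t" if "s \<in> triangles (edges_of t)" for s
  proof (rule card_subset_eq)
    show "finite t" using assms card.infinite by fastforce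
    show "s \<subseteq> t" using that assms Union_edges_of[of s] Union_edges_of[of t] unfolding triangles_iff by blast
    show "card s = card t" using that assms unfolding triangles_iff by simp
  qed
  moreover have "t \<in> triangles (edges_of t)" using assms by (simp add: triangles_iff)
  ultimately show ?thesis by blast
qed

lemma triangle_subset:
  assumes "t \<in> triangles E" "\<And>e. e \<in> E \<Longrightarrow> e \<subseteq> V"
  shows "t \<subseteq> V"
proof -
  have "edges_of t \<subseteq> E" "\<Union>(edges_of t) = t" using assms(1) Union_edges_of by (auto simp: triangles_iff)
  then show ?thesis using assms(2) by (metis Union_least subsetD)
qed

section \<open>Growth of a 3-tree by one vertex\<close>

lemma three_tree_edges:
  assumes "three_tree V E"
  shows "finite E" "\<And>e. e \<in> E \<Longrightarrow> e \<subseteq> V"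
proof -
  from assms have "finite E \<and> (\<forall>e\<in>E. e \<subseteq> V)"
  proof induction
    case (step V E a b c v)
    have "{a, b, c} \<subseteq> V" using step.hyps(2) step.IH triangle_subset by blast
    then show ?case using step.IH by auto
  qed (auto simp: tri_edges_def)
  then show "finite E" "\<And>e. e \<in> E \<Longrightarrow> e \<subseteq> V" by blast+
qed

text \<open>The neighbours of \<open>v\<close> are exactly the vertices of \<open>t\<close>, so a
  triangle through \<open>v\<close> is completed by an edge of \<open>t\<close>; a triangle avoiding
  \<open>v\<close> uses no new edge.\<close>

lemma triangles_new_vertex:
  assumes sub: "\<And>e. e \<in> E \<Longrightarrow> e \<subseteq> V" and t: "t \<in> triangles E" and v: "v \<notin> V"
  shows "triangles (E \<union> (\<lambda>x. {v, x}) ` t) = triangles E \<union> insert v ` edges_of t"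
proof (intro equalityI subsetI)
  fix s assume s: "s \<in> triangles (E \<union> (\<lambda>x. {v, x}) ` t)"
  then have s3: "card s = 3" and sE: "edges_of s \<subseteq> E \<union> (\<lambda>x. {v, x}) ` t" by (auto simp: triangles_iff)
  show "s \<in> triangles E \<union> insert v ` edges_of t"
  proof (cases "v \<in> s")
    case True
    have "card (s - {v}) = 2" using s3 True by simp
    moreover have "x \<in> t" if "x \<in> s - {v}" for x
    proof -
      have "{v, x} \<in> edges_of s" using that True by (auto simp: edges_of_def)
      moreover have "{v, x} \<notin> E" using sub[of "{v, x}"] v by auto
      ultimately have "{v, x} \<in> (\<lambda>x. {v, x}) ` t" using sE by (metis UnE subsetD)
      then show ?thesis using that by (auto simp: doubleton_eq_iff)
    qed
    ultimately have "s - {v} \<in> edges_of t" unfolding edges_of_def by blast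
    moreover have "s = insert v (s - {v})" using True by blast
    ultimately show ?thesis by (metis UnI2 imageI)
  next
    case False
    then have "e \<notin> (\<lambda>x. {v, x}) ` t" if "e \<in> edges_of s" for e
      using that unfolding edges_of_def by blast
    then have "edges_of s \<subseteq> E" using sE by blast
    then show ?thesis using s3 by (simp add: triangles_iff)
  qed
next
  have tV: "t \<subseteq> V" using t sub by (rule triangle_subset)
  fix s assume "s \<in> triangles E \<union> insert v ` edges_of t"
  then consider "s \<in> triangles E" | e where "e \<in> edges_of t" "s = insert v e" by blast
  then show "s \<in> triangles (E \<union> (\<lambda>x. {v, x}) ` t)"
  proof cases
    case 1
    then show ?thesis by (auto simp: triangles_iff)
  next
    case 2
    then obtain p q where pq: "e = {p, q}" "p \<noteq> q" "p \<in> t" "q \<in> t"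
      by (auto simp: edges_of_def card_2_iff)
    have "v \<noteq> p" "v \<noteq> q" using pq tV v by auto
    then have "edges_of s = {{v, p}, {p, q}, {v, q}}" "card s = 3"
      unfolding 2(2) pq(1) using pq(2) by (simp_all add: edges_of_triple tri_edges_def)
    moreover have "{p, q} \<in> E" using 2(1) pq(1) t by (auto simp: triangles_iff)
    ultimately show ?thesis using pq by (simp add: triangles_iff)
  qed
qed

text \<open>
Quantifying over all orderings of the vertices makes any symmetry argument for \<^const>\<open>gadgets\<close>
unnecessary.
\<close>

definition good_tri :: "'a set \<Rightarrow> 'a set set \<Rightarrow> 'a set set set \<Rightarrow> bool" where
  "good_tri t D H \<longleftrightarrow> (\<forall>a b c. t = {a, b, c} \<longrightarrow> good {a, b} {b, c} {a, c} D H)"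

text \<open>The gadgets on the three triangles at \<open>v\<close> are merged by
  \<open>good_ext\<close> into one on \<open>t\<close>, with the edges at \<open>v\<close> now
  private; \<open>good_glue\<close> then joins it to the gadget already on \<open>t\<close>.\<close>

lemma good_tri_new_vertex:
  assumes t: "card t = 3" and v: "v \<notin> t"
    and good0: "good_tri t (D t) (H t)"
    and good1: "\<And>e. e \<in> edges_of t \<Longrightarrow> good_tri (insert v e) (D (insert v e)) (H (insert v e))"
    and disj: "\<And>r s. r \<in> insert t (insert v ` edges_of t) \<Longrightarrow> s \<in> insert t (insert v ` edges_of t) \<Longrightarrow>
      r \<noteq> s \<Longrightarrow> D r \<inter> D s = {}"
    and fresh: "\<And>s. s \<in> insert t (insert v ` edges_of t) \<Longrightarrow>
      D s \<inter> (edges_of t \<union> (\<lambda>x. {v, x}) ` t) = {}"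
  shows "good_tri t (D t \<union> \<Union>(D ` insert v ` edges_of t) \<union> (\<lambda>x. {v, x}) ` t)
    (H t \<union> \<Union>(H ` insert v ` edges_of t))"
  unfolding good_tri_def
proof (intro allI impI)
  fix p q r assume eq: "t = {p, q, r}"
  then have d: "p \<noteq> q" "q \<noteq> r" "p \<noteq> r" and v': "v \<noteq> p" "v \<noteq> q" "v \<noteq> r"
    using card_3_distinct[of p q r] t v unfolding eq by auto
  have edges: "edges_of t = {{p, q}, {q, r}, {p, r}}"
    unfolding eq edges_of_triple[OF d] tri_edges_def ..
  let ?D1 = "D {v, p, q}" and ?D2 = "D {v, q, r}" and ?D3 = "D {v, p, r}"
  let ?H1 = "H {v, p, q}" and ?H2 = "H {v, q, r}" and ?H3 = "H {v, p, r}"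
  have N: "insert v ` edges_of t = {{v, p, q}, {v, q, r}, {v, p, r}}" unfolding edges by simp
  have "p \<notin> {v, q, r}" "q \<notin> {v, p, r}" using d v' by simp_all
  then have ne: "{v, p, q} \<noteq> {v, q, r}" "{v, p, q} \<noteq> {v, p, r}" "{v, q, r} \<noteq> {v, p, r}"
    by (metis insertI1 insertI2)+
  have ne_t: "t \<noteq> {v, p, q}" "t \<noteq> {v, q, r}" "t \<noteq> {v, p, r}"
    using v by (metis insertI1)+
  have D12: "?D1 \<inter> ?D2 = {}" and D13: "?D1 \<inter> ?D3 = {}" and D23: "?D2 \<inter> ?D3 = {}"
    using disj[OF _ _ ne(1)] disj[OF _ _ ne(2)] disj[OF _ _ ne(3)]
    by (simp_all only: N insert_iff simp_thms)
  have D0: "D t \<inter> ?D1 = {}" "D t \<inter> ?D2 = {}" "D t \<inter> ?D3 = {}"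
    using disj[OF _ _ ne_t(1)] disj[OF _ _ ne_t(2)] disj[OF _ _ ne_t(3)]
    by (simp_all only: N insert_iff simp_thms)
  have img: "(\<lambda>x. {v, x}) ` t = {{v, p}, {v, q}, {v, r}}" unfolding eq by simp
  let ?B = "{{p, q}, {q, r}, {p, r}, {v, p}, {v, q}, {v, r}}"
  have "D s \<inter> ?B = {}" if "s \<in> {t, {v, p, q}, {v, q, r}, {v, p, r}}" for s
    using fresh[of s, unfolded N, unfolded edges img] that by (simp only: Un_insert_left Un_empty_left)
  then have fr: "D t \<inter> ?B = {}" "?D1 \<inter> ?B = {}" "?D2 \<inter> ?B = {}" "?D3 \<inter> ?B = {}"
    by (simp_all only: insert_iff simp_thms)
  have dist: "distinct [{p, q}, {q, r}, {p, r}, {v, p}, {v, q}, {v, r}]"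
    using d v' by (auto simp: doubleton_eq_iff)
  have g: "good {a, b} {v, b} {v, a} (D {v, a, b}) (H {v, a, b})" if "{a, b} \<in> edges_of t" for a b
    using good1[OF that, unfolded good_tri_def, rule_format, of a b v] by (simp add: insert_commute)
  \<comment> \<open>\<open>good_ext\<close> expects a cyclic pattern in which each edge at
    \<open>v\<close> is second in one gadget and third in another. This is why \<open>p\<close> and
    \<open>r\<close> are swapped for \<open>g3\<close>.\<close>
  have g1: "good {p, q} {v, q} {v, p} ?D1 ?H1" and g2: "good {q, r} {v, r} {v, q} ?D2 ?H2"
    by (rule g, simp add: edges)+
  have g3: "good {p, r} {v, p} {v, r} ?D3 ?H3"
    using g[of r p] by (simp add: edges insert_commute)
  have ext: "good {p, q} {q, r} {p, r} (?D1 \<union> ?D2 \<union> ?D3 \<union> {{v, p}, {v, q}, {v, r}}) (?H1 \<union> ?H2 \<union> ?H3)"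
    using g1 g2 g3 dist D12 D13 D23 
    by (rule good_ext) (simp only: Int_Un_distrib2 fr Un_empty_left)
  have "good {p, q} {q, r} {p, r} (D t \<union> (?D1 \<union> ?D2 \<union> ?D3 \<union> {{v, p}, {v, q}, {v, r}}))
      (H t \<union> (?H1 \<union> ?H2 \<union> ?H3))"
  proof (rule good_glue)
    show "good {p, q} {q, r} {p, r} (D t) (H t)" using good0 eq unfolding good_tri_def by blast
    show "distinct [{p, q}, {q, r}, {p, r}]" using dist by simp
    show "D t \<inter> (?D1 \<union> ?D2 \<union> ?D3 \<union> {{v, p}, {v, q}, {v, r}}) = {}" using D0 fr(1) by auto
    show "(D t \<union> (?D1 \<union> ?D2 \<union> ?D3 \<union> {{v, p}, {v, q}, {v, r}})) \<inter> {{p, q}, {q, r}, {p, r}} = {}"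
      using fr dist by auto
  qed (rule ext)
  moreover have "D t \<union> \<Union>(D ` insert v ` edges_of t) \<union> (\<lambda>x. {v, x}) ` t
      = D t \<union> (?D1 \<union> ?D2 \<union> ?D3 \<union> {{v, p}, {v, q}, {v, r}})"
    unfolding N img by auto
  moreover have "H t \<union> \<Union>(H ` insert v ` edges_of t) = H t \<union> (?H1 \<union> ?H2 \<union> ?H3)"
    unfolding N by auto
  ultimately show "good {p, q} {q, r} {p, r} (D t \<union> \<Union>(D ` insert v ` edges_of t) \<union> (\<lambda>x. {v, x}) ` t)
      (H t \<union> \<Union>(H ` insert v ` edges_of t))" by simp
qed

text \<open>Generalising to a 3-tree whose triangles carry arbitrary good gadgets makes the
  induction work: deleting the last vertex changes only the gadget on one triangle. The private
  edges avoid the current tree and one another.\<close>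

lemma three_tree_gadgets_bound:
  assumes "three_tree V E"
    and "\<And>t. t \<in> triangles E \<Longrightarrow> good_tri t (D t) (H t)"
    and "\<And>t. t \<in> triangles E \<Longrightarrow> D t \<inter> E = {}"
    and "\<And>s t. s \<in> triangles E \<Longrightarrow> t \<in> triangles E \<Longrightarrow> s \<noteq> t \<Longrightarrow> D s \<inter> D t = {}"
  shows "\<exists>k l. 5 * l \<le> 9 * k + 1 \<and> packs UNIV (\<Union>(H ` triangles E)) k \<and> covers {} (\<Union>(H ` triangles E)) l"
  using assms
proof (induction arbitrary: D H)
  case (base a b c)
  have "card {a, b, c} = 3" using base.hyps by simp
  then have T: "triangles (tri_edges a b c) = {{a, b, c}}"
    using triangles_single[of "{a, b, c}"] edges_of_triple[OF base.hyps] by simp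
  have "good {a, b} {b, c} {a, c} (D {a, b, c}) (H {a, b, c})"
    using base.prems(1)[of "{a, b, c}"] unfolding T good_tri_def by simp
  then show ?case unfolding T by (rule good_bound) auto
next
  case (step V E a b c v)
  define t where "t = {a, b, c}"
  define N where "N = insert v ` edges_of t"
  define F where "F = (\<lambda>x. {v, x}) ` t"
  have sub: "\<And>e. e \<in> E \<Longrightarrow> e \<subseteq> V" using three_tree_edges(2)[OF step.hyps(1)] .
  have t: "t \<in> triangles E" using step.hyps(2) by (simp add: t_def)
  have t3: "card t = 3" and tE: "edges_of t \<subseteq> E" using t by (auto simp: triangles_iff)
  have E': "E \<union> {{v, a}, {v, b}, {v, c}} = E \<union> F" unfolding F_def t_def by auto
  have T: "triangles (E \<union> F) = triangles E \<union> N"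
    unfolding F_def N_def using sub t step.hyps(3) by (rule triangles_new_vertex)
  note prems = step.prems[unfolded E' T]
  have v_notin: "v \<notin> s" if "s \<in> triangles E" for s
    using triangle_subset[OF that sub] step.hyps(3) by blast
  have FE: "F \<inter> E = {}" using sub step.hyps(3) unfolding F_def by blast
  have NE: "N \<inter> triangles E = {}" using v_notin unfolding N_def by blast
  \<comment> \<open>The triangle \<open>t\<close> absorbs the gadgets of the triangles at
    \<open>v\<close>, and the edges at \<open>v\<close> become private to it.\<close>
  define D' where "D' s = (if s = t then D t \<union> \<Union>(D ` N) \<union> F else D s)" for s
  define H' where "H' s = (if s = t then H t \<union> \<Union>(H ` N) else H s)" for s
  have "\<exists>k l. 5 * l \<le> 9 * k + 1 \<and> packs UNIV (\<Union>(H' ` triangles E)) k \<and> covers {} (\<Union>(H' ` triangles E)) l"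
  proof (rule step.IH)
    fix s assume s: "s \<in> triangles E"
    show "good_tri s (D' s) (H' s)"
    proof (cases "s = t")
      case True
      have tN: "insert t N \<subseteq> triangles E \<union> N" using t by blast
      have "good_tri t (D t \<union> \<Union>(D ` insert v ` edges_of t) \<union> (\<lambda>x. {v, x}) ` t)
          (H t \<union> \<Union>(H ` insert v ` edges_of t))"
      proof (rule good_tri_new_vertex[OF t3 v_notin[OF t]], unfold N_def[symmetric] F_def[symmetric])
        show "good_tri t (D t) (H t)" using prems(1) t by blast
        show "good_tri (insert v e) (D (insert v e)) (H (insert v e))" if "e \<in> edges_of t" for e
          using prems(1) that unfolding N_def by blast
        show "D r \<inter> D s = {}" if "r \<in> insert t N" "s \<in> insert t N" "r \<noteq> s" for r s
          using prems(3) that tN by blast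
        show "D s \<inter> (edges_of t \<union> F) = {}" if "s \<in> insert t N" for s
          using prems(2)[of s] that tN tE by blast
      qed
      then show ?thesis using True unfolding D'_def H'_def N_def F_def by simp
    next
      case False
      then show ?thesis using prems(1) s unfolding D'_def H'_def by simp
    qed
    show "D' s \<inter> E = {}"
    proof (cases "s = t")
      case True
      have "D n \<inter> E = {}" if "n \<in> insert t N" for n using prems(2)[of n] that t by blast
      then show ?thesis using True FE unfolding D'_def by auto
    next
      case False
      then show ?thesis using prems(2)[of s] s unfolding D'_def by auto
    qed
    fix r assume r: "r \<in> triangles E" and "s \<noteq> r"
    have *: "(D t \<union> \<Union>(D ` N) \<union> F) \<inter> D q = {}" if "q \<in> triangles E" "q \<noteq> t" for q
    proof -
      have "D t \<inter> D q = {}" using prems(3)[of t q] t that by blast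
      moreover have "D n \<inter> D q = {}" if "n \<in> N" for n
        using prems(3)[of n q] that \<open>q \<in> triangles E\<close> NE by blast
      moreover have "F \<inter> D q = {}" using prems(2)[of q] that by blast
      ultimately show ?thesis by blast
    qed
    show "D' s \<inter> D' r = {}"
    proof (cases "s = t")
      case True
      then show ?thesis using *[OF r] \<open>s \<noteq> r\<close> unfolding D'_def by simp
    next
      case s_ne: False
      show ?thesis
      proof (cases "r = t")
        case True
        then show ?thesis using *[OF s] s_ne unfolding D'_def by (simp add: Int_commute)
      next
        case False
        then show ?thesis using prems(3)[of s r] s r s_ne \<open>s \<noteq> r\<close> unfolding D'_def by simp
      qed
    qed
  qed
  \<comment> \<open>Absorption only regroups the set system, so both bounds carry over
    unchanged.\<close>
  moreover have "\<Union>(H' ` triangles E) = \<Union>(H ` (triangles E \<union> N))"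
    using t unfolding H'_def by (auto split: if_splits)
  ultimately show ?case unfolding E' T by simp
qed

section \<open>Back from set systems to \<open>nu\<close> and \<open>tau\<close>\<close>

lemma nu_ge:
  assumes "finite E" "packs UNIV (edges_of ` triangles E) k"
  shows "k \<le> int (nu E)"
proof -
  let ?R = "\<lambda>k. \<exists>P. P \<subseteq> triangles E \<and> finite P \<and> card P = k \<and>
      (\<forall>S\<in>P. \<forall>T\<in>P. S \<noteq> T \<longrightarrow> edges_of S \<inter> edges_of T = {})"
  obtain M where M: "M \<subseteq> edges_of ` triangles E" "finite M" "pairwise disjnt M" "k \<le> int (card M)"
    using assms(2) by (rule packsE)
  obtain P where P: "P \<subseteq> triangles E" "M = edges_of ` P" using M(1) by (rule subset_imageE)
  have inj: "inj_on edges_of P" using inj_on_edges_of P(1) by (rule inj_on_subset)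
  \<comment> \<open>Finiteness of \<open>triangles E\<close> follows by embedding it into the power
    set of \<open>E\<close>; it supplies the upper bound that \<open>GREATEST\<close>
    requires.\<close>
  have "edges_of ` triangles E \<subseteq> Pow E" by (simp add: image_subset_iff triangles_iff)
  then have "finite (edges_of ` triangles E)" by (rule finite_subset) (simp add: assms(1))
  then have fin: "finite (triangles E)" using inj_on_edges_of by (rule finite_imageD)
  have disj: "edges_of S \<inter> edges_of T = {}" if "S \<in> P" "T \<in> P" "S \<noteq> T" for S T
  proof -
    have "edges_of S \<noteq> edges_of T" using inj that by (simp add: inj_on_eq_iff)
    with M(3) that show ?thesis by (simp add: P(2) pairwise_def disjnt_def)
  qed
  have "?R (card P)"
    by (intro exI[of _ P] conjI ballI impI P(1) finite_subset[OF P(1) fin] refl disj)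
  moreover have "n \<le> card (triangles E)" if "?R n" for n
    using that
  proof (elim exE conjE)
    fix P' assume "P' \<subseteq> triangles E" "card P' = n"
    then show ?thesis using card_mono[OF fin, of P'] by simp
  qed
  ultimately have "card P \<le> nu E"
    unfolding nu_def by (rule Greatest_le_nat[where P = ?R])
  moreover have "card M = card P" unfolding P(2) using inj by (rule card_image)
  ultimately show ?thesis using M(4) by simp
qed

lemma tau_le:
  assumes "finite E" "covers {} (edges_of ` triangles E) l"
  shows "int (tau E) \<le> l"
proof -
  obtain F where F: "finite F" "\<forall>t\<in>edges_of ` triangles E. t \<inter> ({} \<union> F) \<noteq> {}" "int (card F) \<le> l"
    using assms(2) by (rule coversE)
  \<comment> \<open>The cover \<open>F\<close> may contain sets that are not edges, whereas
    \<open>tau\<close> admits only subsets of \<open>E\<close>; hence the intersection.\<close>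
  have "triangles (E - F \<inter> E) = {}"
  proof (rule ccontr)
    assume "triangles (E - F \<inter> E) \<noteq> {}"
    then obtain t where t: "card t = 3" "edges_of t \<subseteq> E - F \<inter> E" by (auto simp: triangles_iff)
    then have "t \<in> triangles E" by (auto simp: triangles_iff)
    then have "edges_of t \<inter> F \<noteq> {}" using F(2) by auto
    then show False using t(2) by blast
  qed
  then have "tau E \<le> card (F \<inter> E)"
    unfolding tau_def triangle_free_def by (intro Least_le exI[of _ "F \<inter> E"]) simp
  also have "\<dots> \<le> card F" using F(1) by (simp add: card_mono)
  finally show ?thesis using F(3) by simp
qed

theorem theorem5p1:
  fixes V :: "'a set" and E :: "'a set set"
  assumes "three_tree V E"
  shows "real (tau E) \<le> 9/5 * real (nu E) + 1/5"
proof -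
  \<comment> \<open>Initially each triangle carries just itself, with no private edges.\<close>
  have "good_tri t {} {edges_of t}" if "t \<in> triangles E" for t
    unfolding good_tri_def
  proof (intro allI impI)
    fix a b c assume eq: "t = {a, b, c}"
    have "edges_of t = {{a, b}, {b, c}, {a, c}}"
      using that edges_of_triple card_3_distinct unfolding eq triangles_iff tri_edges_def by metis
    then show "good {a, b} {b, c} {a, c} {} {edges_of t}" by (simp add: good_triangle)
  qed
  then have "\<exists>k l. 5 * l \<le> 9 * k + 1 \<and> packs UNIV (\<Union>((\<lambda>t. {edges_of t}) ` triangles E)) k
      \<and> covers {} (\<Union>((\<lambda>t. {edges_of t}) ` triangles E)) l"
    by (intro three_tree_gadgets_bound[OF assms, where D = "\<lambda>_. {}"]) auto
  moreover have "\<Union>((\<lambda>t. {edges_of t}) ` triangles E) = edges_of ` triangles E" by auto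
  ultimately obtain k l where kl: "5 * l \<le> 9 * k + 1" "packs UNIV (edges_of ` triangles E) k"
      "covers {} (edges_of ` triangles E) l"
    by auto
  have "finite E" using assms by (rule three_tree_edges)
  then have "5 * int (tau E) \<le> 9 * int (nu E) + 1"
    using nu_ge[OF _ kl(2)] tau_le[OF _ kl(3)] kl(1) by simp
  then show ?thesis by linarith
qed

end
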